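(* Let Assumption 1 hold, let $\alpha\in(0,1)$ and $b\in\mathcal B$. Under the null hypothesis $H_0:\beta=b$, $$\mathbb{P}\left(T_n(b)\le q_{1-\alpha}\mid \mathcal{X}_n\right)\ge 1-\alpha .$$
   Context: Setting. $n,K\ge 1$ are integers; $Y_i\in\{0,1\}$, $X_i$ is a row vector in $\mathbb{R}^K$, $U_i$ is real valued, $i=1,\dots,n$; $\mathcal{X}_n\equiv(X_1,\dots,X_n)$. The analysis is conditional on $\mathcal{X}_n$ (it may be read for a fixed realization of $\mathcal{X}_n$). For any expression in $(Y,X)$, $\mathbb{E}_n[\cdot]\equiv n^{-1}\sum_{i=1}^n[\cdot]$, where $(Y,X)$ is evaluated at $(Y_i,X_i)$ in the $i$th summand. Assumption 1. (i) The random vectors $(Y_i,X_i,U_i)$, $i=1,\dots,n$, are defined on a probability space $(\Omega,\mathfrak F,\mathbb P)$, where $\mathfrak F$ contains the Borel sets on $\Omega$. (ii) $(Y_i,X_i)$, $i=1,\dots,n$, are observed. (iii) There is a column vector $\beta\in\mathbb{R}^K$ such that $\mathbb P(Y_i=1\{X_i\beta+U_i\ge 0\}\mid\mathcal X_n)=1$ and $\mathbb P(U_i\ge 0\mid\mathcal X_n)=1/2$ for every $i$. (iv) $\beta$ belongs to a known set $\mathcal B\subseteq\mathbb R^K$. (v) $1\{U_1\ge0\},\dots,1\{U_n\ge0\}$ are mutually independent conditional on $\mathcal X_n$. Test statistic. $\mathcal V_u,\mathcal V_l\subseteq\mathbb R^K$ are (nonempty) index sets and $\epsilon>0$ is a fixed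 (small) number. Define $\hat m_u(b,v)\equiv\mathbb E_n[(2Y-1)1\{Xb\ge0,Xv<0\}]$, $\hat m_l(b,v)\equiv\mathbb E_n[(1-2Y)1\{Xb\le0,Xv>0\}]$, $\hat\sigma_u^2(b,v)\equiv\mathbb E_n[1\{Xb\ge0,Xv<0\}]-\hat m_u(b,v)^2$, $\hat\sigma_l^2(b,v)\equiv\mathbb E_n[1\{Xb\le0,Xv>0\}]-\hat m_l(b,v)^2$, $\hat T_c(b,\mathcal V)\equiv\sup_{v\in\mathcal V}\sqrt n\,\frac{-\hat m_c(b,v)}{\max\{\hat\sigma_c(b,v),\epsilon\}}$ for $c\in\{u,l\}$, and $T_n(b)\equiv\max\{0,\hat T_u(b,\mathcal V_u),\hat T_l(b,\mathcal V_l)\}$. Critical value. Let $Y_i^*\equiv1\{U_i\ge0\}$ and let $T_n^*(b)$ be defined exactly as $T_n(b)$ but with $Y_i$ replaced by $Y_i^*$ for all $i$ (in the $\hat m$'s and hence in the $\hat\sigma$'s). Given $\mathcal X_n$, the variables $2Y_i^*-1$ are independent Rademacher variables, so the conditional law of $T_n^*(b)$ is known. Define $q_{1-\alpha}\equiv\inf\{c\in\mathbb R:\mathbb P(T_n^*(b)\le c\mid\mathcal X_n)\ge1-\alpha\}$. *)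

theory Defs
  imports "HOL-Probability.Probability"
begin

text \<open>
  Everything is conditional on the regressors: \<open>X 1, \<dots>, X n\<close> are a fixed realization, and \<open>M\<close> is the
  probability space equipped with the conditional probability given that realization.  The
  observations are indexed by \<open>{1..n}\<close>, the dimension is \<open>K = CARD('k)\<close>, and the product of a row
  vector and a column vector is the inner product.
\<close>

locale binary_response = prob_space M
  for M :: "'w measure" +
  fixes \<tau> :: "'w topology"
    and n :: nat
    and X :: "nat \<Rightarrow> real ^ 'k"
    and Y U :: "nat \<Rightarrow> 'w \<Rightarrow> real"
    and B :: "(real ^ 'k) set"
    and \<beta> :: "real ^ 'k"
  assumes n_pos: "n \<ge> 1"
    and topspace_eq: "topspace \<tau> = space M"
    and borel_sets: "sigma_sets (space M) {A. openin \<tau> A} \<subseteq> sets M"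
    and rv_Y: "\<And>i. i \<in> {1..n} \<Longrightarrow> random_variable borel (Y i)"
    and rv_U: "\<And>i. i \<in> {1..n} \<Longrightarrow> random_variable borel (U i)"
    and Y_binary: "\<And>i \<omega>. i \<in> {1..n} \<Longrightarrow> \<omega> \<in> space M \<Longrightarrow> Y i \<omega> \<in> {0, 1}"
    and response: "\<And>i. i \<in> {1..n} \<Longrightarrow> \<P>(\<omega> in M. Y i \<omega> = of_bool (X i \<bullet> \<beta> + U i \<omega> \<ge> 0)) = 1"
    and median: "\<And>i. i \<in> {1..n} \<Longrightarrow> \<P>(\<omega> in M. U i \<omega> \<ge> 0) = 1 / 2"
    and param: "\<beta> \<in> B"
    and indep_signs: "indep_vars (\<lambda>_. borel) (\<lambda>i \<omega>. of_bool (U i \<omega> \<ge> 0) :: real) {1..n}"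

definition emp_mean :: "nat \<Rightarrow> (nat \<Rightarrow> real) \<Rightarrow> real" where
  "emp_mean n f = (\<Sum>i=1..n. f i) / real n"

text \<open>In the following, \<open>y\<close> is a realization of the outcomes.\<close>

definition m_u :: "nat \<Rightarrow> (nat \<Rightarrow> real ^ 'k) \<Rightarrow> (nat \<Rightarrow> real) \<Rightarrow> real ^ 'k \<Rightarrow> real ^ 'k \<Rightarrow> real" where
  "m_u n X y b v = emp_mean n (\<lambda>i. (2 * y i - 1) * of_bool (X i \<bullet> b \<ge> 0 \<and> X i \<bullet> v < 0))"

definition m_l :: "nat \<Rightarrow> (nat \<Rightarrow> real ^ 'k) \<Rightarrow> (nat \<Rightarrow> real) \<Rightarrow> real ^ 'k \<Rightarrow> real ^ 'k \<Rightarrow> real" where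
  "m_l n X y b v = emp_mean n (\<lambda>i. (1 - 2 * y i) * of_bool (X i \<bullet> b \<le> 0 \<and> X i \<bullet> v > 0))"

definition sigma2_u :: "nat \<Rightarrow> (nat \<Rightarrow> real ^ 'k) \<Rightarrow> (nat \<Rightarrow> real) \<Rightarrow> real ^ 'k \<Rightarrow> real ^ 'k \<Rightarrow> real" where
  "sigma2_u n X y b v =
     emp_mean n (\<lambda>i. of_bool (X i \<bullet> b \<ge> 0 \<and> X i \<bullet> v < 0)) - (m_u n X y b v)\<^sup>2"

definition sigma2_l :: "nat \<Rightarrow> (nat \<Rightarrow> real ^ 'k) \<Rightarrow> (nat \<Rightarrow> real) \<Rightarrow> real ^ 'k \<Rightarrow> real ^ 'k \<Rightarrow> real" where
  "sigma2_l n X y b v =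
     emp_mean n (\<lambda>i. of_bool (X i \<bullet> b \<le> 0 \<and> X i \<bullet> v > 0)) - (m_l n X y b v)\<^sup>2"

text \<open>
  For \<open>\<epsilon> > 0\<close> and outcomes in \<open>{0, 1}\<close>, the studentized moments are bounded in absolute value by
  \<open>sqrt n / \<epsilon>\<close>, so for a nonempty index set the suprema below are genuine real suprema.
\<close>

definition T_u ::
  "real \<Rightarrow> nat \<Rightarrow> (nat \<Rightarrow> real ^ 'k) \<Rightarrow> (nat \<Rightarrow> real) \<Rightarrow> real ^ 'k \<Rightarrow> (real ^ 'k) set \<Rightarrow> real" where
  "T_u \<epsilon> n X y b V =
     (SUP v\<in>V. sqrt (real n) * (- m_u n X y b v / max (sqrt (sigma2_u n X y b v)) \<epsilon>))"

definition T_l ::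
  "real \<Rightarrow> nat \<Rightarrow> (nat \<Rightarrow> real ^ 'k) \<Rightarrow> (nat \<Rightarrow> real) \<Rightarrow> real ^ 'k \<Rightarrow> (real ^ 'k) set \<Rightarrow> real" where
  "T_l \<epsilon> n X y b V =
     (SUP v\<in>V. sqrt (real n) * (- m_l n X y b v / max (sqrt (sigma2_l n X y b v)) \<epsilon>))"

definition test_stat ::
  "real \<Rightarrow> (real ^ 'k) set \<Rightarrow> (real ^ 'k) set \<Rightarrow> nat \<Rightarrow> (nat \<Rightarrow> real ^ 'k) \<Rightarrow> (nat \<Rightarrow> real)
     \<Rightarrow> real ^ 'k \<Rightarrow> real" where
  "test_stat \<epsilon> V\<^sub>u V\<^sub>l n X y b = Max {0, T_u \<epsilon> n X y b V\<^sub>u, T_l \<epsilon> n X y b V\<^sub>l}"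

definition Y_star :: "(nat \<Rightarrow> 'w \<Rightarrow> real) \<Rightarrow> nat \<Rightarrow> 'w \<Rightarrow> real" where
  "Y_star U i \<omega> = of_bool (U i \<omega> \<ge> 0)"

definition crit_val ::
  "'w measure \<Rightarrow> (nat \<Rightarrow> 'w \<Rightarrow> real) \<Rightarrow> real \<Rightarrow> real \<Rightarrow> (real ^ 'k) set \<Rightarrow> (real ^ 'k) set
     \<Rightarrow> nat \<Rightarrow> (nat \<Rightarrow> real ^ 'k) \<Rightarrow> real ^ 'k \<Rightarrow> real" where
  "crit_val M U \<alpha> \<epsilon> V\<^sub>u V\<^sub>l n X b =
     Inf {c. \<P>(\<omega> in M. test_stat \<epsilon> V\<^sub>u V\<^sub>l n X (\<lambda>i. Y_star U i \<omega>) b \<le> c) \<ge> 1 - \<alpha>}"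

end

theory Submission
  imports Defs
begin

text \<open>
  Under the null, \<open>Y i \<ge> Y_star U i\<close> whenever \<open>X i \<bullet> b \<ge> 0\<close> and \<open>Y i \<le> Y_star U i\<close> whenever
  \<open>X i \<bullet> b \<le> 0\<close>, almost surely.  Hence both empirical moments can only decrease when the outcomes
  are replaced by \<open>Y_star\<close>.  For a fixed second moment, the studentized moment is monotone in the
  moment itself: a moment further away from zero also has a smaller variance estimate.  So the
  test statistic is almost surely dominated by its starred version, whose quantile is the
  critical value.
\<close>

text \<open>The infimum defining the quantile is attained: the distribution function is at least
  \<open>p\<close> everywhere to the right of the infimum, and right-continuity carries this bound
  to the infimum itself.\<close>

lemma (in prob_space) prob_le_Inf_quantile:
  fixes Z :: "'a \<Rightarrow> real"
  assumes Z: "random_variable borel Z" and p: "0 < p" "p < 1"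
  shows "p \<le> \<P>(\<omega> in M. Z \<omega> \<le> Inf {c. p \<le> \<P>(\<omega> in M. Z \<omega> \<le> c)})"
proof -
  interpret D: real_distribution "distr M borel Z"
    using Z by (rule real_distribution_distr)
  define F where "F = cdf (distr M borel Z)"
  have F_eq: "F c = \<P>(\<omega> in M. Z \<omega> \<le> c)" for c
    unfolding F_def cdf_def using Z by (simp add: measure_distr vimage_def Int_def conj_commute)
  define q where "q = Inf {c. p \<le> F c}"
  have F_mono: "F c \<le> F d" if "c \<le> d" for c d
    unfolding F_def using that by (rule D.cdf_nondecreasing)
  \<comment> \<open>The distribution function tends to 1 > \<open>p\<close>, so the infimum is not
    taken over the empty set.\<close>
  have "eventually (\<lambda>c. p < F c) at_top"
    using order_tendstoD(1)[OF D.cdf_lim_at_top_prob p(2)] unfolding F_def .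
  then have nonempty: "{c. p \<le> F c} \<noteq> {}"
    by (auto simp: eventually_at_top_linorder intro: less_imp_le)
  have ev: "eventually (\<lambda>c. p \<le> F c) (at_right q)"
    unfolding eventually_at_right_field
  proof (intro exI[of _ "q + 1"] conjI allI impI)
    fix c assume "q < c"
    then obtain d where "p \<le> F d" "d < c"
      using cInf_lessD[OF nonempty] unfolding q_def by blast
    then show "p \<le> F c"
      using F_mono[of d c] by simp
  qed simp
  have "(F \<longlongrightarrow> F q) (at_right q)"
    using D.cdf_is_right_cont[of q] unfolding F_def continuous_within .
  then have "p \<le> F q"
    using ev by (rule tendsto_lowerbound) simp
  then show ?thesis
    unfolding q_def F_eq .
qed

text \<open>Gives measurability of a statistic built from suprema over arbitrary, possibly
  uncountable, index sets. A binary vector with finitely many coordinates takes finitely many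
  values, so any function of it factors through a finite discrete space.\<close>

lemma random_variable_finite_binary:
  fixes Z :: "'i \<Rightarrow> 'w \<Rightarrow> real" and F :: "('i \<Rightarrow> real) \<Rightarrow> real"
  assumes I: "finite I"
    and Z: "\<And>i. i \<in> I \<Longrightarrow> Z i \<in> borel_measurable M"
    and binary: "\<And>i \<omega>. i \<in> I \<Longrightarrow> \<omega> \<in> space M \<Longrightarrow> Z i \<omega> \<in> {0, 1}"
    and F: "\<And>y z. (\<And>i. i \<in> I \<Longrightarrow> y i = z i) \<Longrightarrow> F y = F z"
  shows "(\<lambda>\<omega>. F (\<lambda>i. Z i \<omega>)) \<in> borel_measurable M"
proof -
  \<comment> \<open>The set of indices with outcome 1 encodes the whole outcome vector on
    \<open>I\<close>; its indicator recovers the vector there.\<close>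
  define A where "A \<omega> = {i\<in>I. Z i \<omega> = 1}" for \<omega>
  have "A \<in> measurable M (count_space (Pow I))"
  proof (subst measurable_count_space_eq2)
    show "finite (Pow I)" using I by simp
    show "A \<in> space M \<rightarrow> Pow I \<and> (\<forall>J\<in>Pow I. A -` {J} \<inter> space M \<in> sets M)"
    proof (intro conjI ballI)
      show "A \<in> space M \<rightarrow> Pow I" by (auto simp: A_def)
    next
      fix J assume "J \<in> Pow I"
      then have "A \<omega> = J \<longleftrightarrow> (\<forall>i\<in>I. (Z i \<omega> = 1) = (i \<in> J))" for \<omega>
        unfolding A_def by blast
      then have "A -` {J} \<inter> space M = {\<omega> \<in> space M. \<forall>i\<in>I. (Z i \<omega> = 1) = (i \<in> J)}"
        by (simp add: vimage_def Int_def conj_commute)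
      also have "\<dots> \<in> sets M"
      proof -
        have "{\<omega> \<in> space M. (Z i \<omega> = 1) = (i \<in> J)} \<in> sets M" if "i \<in> I" for i
        proof -
          note [measurable] = Z[OF that]
          show ?thesis by measurable
        qed
        then show ?thesis
          using I by (rule sets.sets_Collect_finite_All)
      qed
      finally show "A -` {J} \<inter> space M \<in> sets M" .
    qed
  qed
  then have "(\<lambda>\<omega>. F (indicator (A \<omega>))) \<in> borel_measurable M"
    by (rule measurable_compose[where g = "\<lambda>J. F (indicator J)"]) simp
  also have "?this \<longleftrightarrow> ?thesis"
  proof (rule measurable_cong)
    fix \<omega> assume "\<omega> \<in> space M"
    then show "F (indicator (A \<omega>)) = F (\<lambda>i. Z i \<omega>)"
      using binary by (intro F) (fastforce simp: A_def indicator_def)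
  qed
  finally show ?thesis .
qed

lemma studentized_mono:
  fixes s \<epsilon> x y :: real
  assumes "\<epsilon> > 0" and "x \<le> y"
  shows "x / max (sqrt (s - x\<^sup>2)) \<epsilon> \<le> y / max (sqrt (s - y\<^sup>2)) \<epsilon>"
proof -
  define D where "D t = max (sqrt (s - t\<^sup>2)) \<epsilon>" for t
  have D_pos: "D t > 0" for t
    using assms(1) by (simp add: D_def)
  \<comment> \<open>The real \<open>sqrt\<close> is monotone on negative arguments too, so the sign
    of \<open>s - t\<^sup>2\<close> does not matter here.\<close>
  have D_anti: "D u \<le> D t" if "\<bar>t\<bar> \<le> \<bar>u\<bar>" for t u
    using that unfolding D_def by (intro max.mono real_sqrt_le_mono) (auto simp: abs_le_square_iff)
  have nonneg: "t / D t \<le> u / D u" if "0 \<le> t" "t \<le> u" for t u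
    using that D_pos D_anti[of t u] by (intro frac_le) auto
  consider "0 \<le> x" | "y \<le> 0" | "x \<le> 0" "0 \<le> y" by linarith
  then have "x / D x \<le> y / D y"
  proof cases
    case 1
    then show ?thesis using nonneg assms by simp
  next
    \<comment> \<open>\<open>D\<close> is even, so the ratio is odd and the nonpositive case is the
      reflection of the nonnegative one.\<close>
    case 2
    have "D (- t) = D t" for t by (simp add: D_def)
    then show ?thesis using nonneg[of "- y" "- x"] 2 assms by simp
  next
    case 3
    then have "x / D x \<le> 0" "0 \<le> y / D y"
      using D_pos[of x] D_pos[of y] by (simp_all add: divide_nonpos_pos)
    then show ?thesis by linarith
  qed
  then show ?thesis by (simp add: D_def)
qed

lemma emp_mean_mono:
  assumes "\<And>i. i \<in> {1..n} \<Longrightarrow> f i \<le> g i"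
  shows "emp_mean n f \<le> emp_mean n g"
  unfolding emp_mean_def using assms by (intro divide_right_mono sum_mono) auto

lemma abs_emp_mean_le_1:
  assumes "\<And>i. i \<in> {1..n} \<Longrightarrow> \<bar>f i\<bar> \<le> 1"
  shows "\<bar>emp_mean n f\<bar> \<le> 1"
proof -
  have "\<bar>\<Sum>i=1..n. f i\<bar> \<le> (\<Sum>i=1..n. \<bar>f i\<bar>)" by (rule sum_abs)
  also have "\<dots> \<le> real (card {1..n}) * 1" using assms by (rule sum_bounded_above)
  finally show ?thesis
    unfolding emp_mean_def by (cases "n = 0") auto
qed

lemma emp_mean_cong:
  assumes "\<And>i. i \<in> {1..n} \<Longrightarrow> f i = g i"
  shows "emp_mean n f = emp_mean n g"
  unfolding emp_mean_def using assms by (auto intro: sum.cong)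

text \<open>Here \<open>s\<close> is the mean of the indicator, which is free of the outcomes and
  hence common to both sides. The bound on \<open>m'\<close> makes the right-hand family bounded
  above by \<open>sqrt n / \<epsilon>\<close>, as comparing real suprema requires.\<close>

lemma SUP_studentized_mono:
  fixes m m' s :: "'v \<Rightarrow> real"
  assumes "\<epsilon> > 0" and "V \<noteq> {}"
    and mono: "\<And>v. v \<in> V \<Longrightarrow> m' v \<le> m v"
    and bounded: "\<And>v. v \<in> V \<Longrightarrow> \<bar>m' v\<bar> \<le> 1"
  shows "(SUP v\<in>V. sqrt (real n) * (- m v / max (sqrt (s v - (m v)\<^sup>2)) \<epsilon>))
    \<le> (SUP v\<in>V. sqrt (real n) * (- m' v / max (sqrt (s v - (m' v)\<^sup>2)) \<epsilon>))"
proof (rule cSUP_mono[OF \<open>V \<noteq> {}\<close>])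
  show "bdd_above ((\<lambda>v. sqrt (real n) * (- m' v / max (sqrt (s v - (m' v)\<^sup>2)) \<epsilon>)) ` V)"
  proof (rule bdd_aboveI2)
    fix v assume "v \<in> V"
    then have "- m' v \<le> 1"
      using bounded[of v] by linarith
    then have "- m' v / max (sqrt (s v - (m' v)\<^sup>2)) \<epsilon> \<le> 1 / \<epsilon>"
      using \<open>\<epsilon> > 0\<close> by (intro frac_le) auto
    then show "sqrt (real n) * (- m' v / max (sqrt (s v - (m' v)\<^sup>2)) \<epsilon>) \<le> sqrt (real n) * (1 / \<epsilon>)"
      by (intro mult_left_mono) auto
  qed
next
  fix v assume v: "v \<in> V"
  have "- m v / max (sqrt (s v - (m v)\<^sup>2)) \<epsilon> \<le> - m' v / max (sqrt (s v - (m' v)\<^sup>2)) \<epsilon>"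
    using studentized_mono[OF \<open>\<epsilon> > 0\<close> mono[OF v], of "s v"] by simp
  then show "\<exists>w\<in>V. sqrt (real n) * (- m v / max (sqrt (s v - (m v)\<^sup>2)) \<epsilon>)
      \<le> sqrt (real n) * (- m' w / max (sqrt (s w - (m' w)\<^sup>2)) \<epsilon>)"
    using v by (intro bexI[of _ v] mult_left_mono) auto
qed

text \<open>The deterministic core, with \<open>y'\<close> in the role of \<open>Y_star\<close>. The
  weight \<open>2 * y i - 1\<close> in \<open>m_u\<close> increases with the outcome and the weight
  \<open>1 - 2 * y i\<close> in \<open>m_l\<close> decreases, so opposite orderings on the two
  half-spaces lower both moments.\<close>

lemma test_stat_mono:
  fixes X :: "nat \<Rightarrow> real ^ 'k"
  assumes "\<epsilon> > 0" and "V\<^sub>u \<noteq> {}" and "V\<^sub>l \<noteq> {}"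
    and upper: "\<And>i. i \<in> {1..n} \<Longrightarrow> X i \<bullet> b \<ge> 0 \<Longrightarrow> y' i \<le> y i"
    and lower: "\<And>i. i \<in> {1..n} \<Longrightarrow> X i \<bullet> b \<le> 0 \<Longrightarrow> y i \<le> y' i"
    and binary: "\<And>i. i \<in> {1..n} \<Longrightarrow> y' i \<in> {0, 1}"
  shows "test_stat \<epsilon> V\<^sub>u V\<^sub>l n X y b \<le> test_stat \<epsilon> V\<^sub>u V\<^sub>l n X y' b"
proof -
  have y': "\<bar>2 * y' i - 1\<bar> \<le> 1" "\<bar>1 - 2 * y' i\<bar> \<le> 1" if "i \<in> {1..n}" for i
    using binary[OF that] by auto
  have "T_u \<epsilon> n X y b V\<^sub>u \<le> T_u \<epsilon> n X y' b V\<^sub>u"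
    unfolding T_u_def sigma2_u_def
  proof (rule SUP_studentized_mono)
    fix v
    show "m_u n X y' b v \<le> m_u n X y b v"
      unfolding m_u_def using upper by (intro emp_mean_mono) (auto simp: of_bool_def)
    show "\<bar>m_u n X y' b v\<bar> \<le> 1"
      unfolding m_u_def using y' by (intro abs_emp_mean_le_1) (auto simp: of_bool_def)
  qed fact+
  moreover have "T_l \<epsilon> n X y b V\<^sub>l \<le> T_l \<epsilon> n X y' b V\<^sub>l"
    unfolding T_l_def sigma2_l_def
  proof (rule SUP_studentized_mono)
    fix v
    show "m_l n X y' b v \<le> m_l n X y b v"
      unfolding m_l_def using lower by (intro emp_mean_mono) (auto simp: of_bool_def)
    show "\<bar>m_l n X y' b v\<bar> \<le> 1"
      unfolding m_l_def using y' by (intro abs_emp_mean_le_1) (auto simp: of_bool_def)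
  qed fact+
  ultimately show ?thesis
    unfolding test_stat_def by (auto simp: le_max_iff_disj)
qed

text \<open>Supplies the dependence on finitely many coordinates that
  \<open>random_variable_finite_binary\<close> asks for.\<close>

lemma test_stat_cong:
  assumes "\<And>i. i \<in> {1..n} \<Longrightarrow> y i = z i"
  shows "test_stat \<epsilon> V\<^sub>u V\<^sub>l n X y b = test_stat \<epsilon> V\<^sub>u V\<^sub>l n X z b"
proof -
  have "m_u n X y b v = m_u n X z b v" "m_l n X y b v = m_l n X z b v" for v
    unfolding m_u_def m_l_def using assms by (auto intro: emp_mean_cong)
  then show ?thesis
    by (simp add: test_stat_def T_u_def T_l_def sigma2_u_def sigma2_l_def)
qed

theorem theorem3:
  fixes M :: "'w measure"
    and \<tau> :: "'w topology"
    and n :: nat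
    and X :: "nat \<Rightarrow> real ^ 'k"
    and Y U :: "nat \<Rightarrow> 'w \<Rightarrow> real"
    and B V\<^sub>u V\<^sub>l :: "(real ^ 'k) set"
    and \<beta> b :: "real ^ 'k"
    and \<alpha> \<epsilon> :: real
  assumes "binary_response M \<tau> n X Y U B \<beta>"
    and "V\<^sub>u \<noteq> {}" and "V\<^sub>l \<noteq> {}" and "\<epsilon> > 0"
    and "0 < \<alpha>" and "\<alpha> < 1"
    and "b \<in> B"
    and H0: "\<beta> = b"
  shows "\<P>(\<omega> in M. test_stat \<epsilon> V\<^sub>u V\<^sub>l n X (\<lambda>i. Y i \<omega>) b \<le> crit_val M U \<alpha> \<epsilon> V\<^sub>u V\<^sub>l n X b) \<ge> 1 - \<alpha>"
proof -
  interpret binary_response M \<tau> n X Y U B \<beta> by fact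
  define T where "T y = test_stat \<epsilon> V\<^sub>u V\<^sub>l n X y b" for y
  have T_cong: "T y = T z" if "\<And>i. i \<in> {1..n} \<Longrightarrow> y i = z i" for y z
    unfolding T_def using that by (rule test_stat_cong)
  have Y_star_measurable: "Y_star U i \<in> borel_measurable M" if "i \<in> {1..n}" for i
  proof -
    note [measurable] = rv_U[OF that]
    show ?thesis unfolding Y_star_def[abs_def] by measurable
  qed
  have Y_star_binary: "Y_star U i \<omega> \<in> {0, 1}" for i \<omega>
    by (simp add: Y_star_def)
  have T_Y [measurable]: "random_variable borel (\<lambda>\<omega>. T (\<lambda>i. Y i \<omega>))"
    using finite_atLeastAtMost rv_Y Y_binary T_cong by (rule random_variable_finite_binary)
  have T_Y_star [measurable]: "random_variable borel (\<lambda>\<omega>. T (\<lambda>i. Y_star U i \<omega>))"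
    using finite_atLeastAtMost Y_star_measurable Y_star_binary T_cong
    by (rule random_variable_finite_binary)
  \<comment> \<open>The response equation has probability one for each observation; a finite union
    of null sets makes it hold for all of them at once.\<close>
  have "AE \<omega> in M. \<forall>i\<in>{1..n}. Y i \<omega> = of_bool (X i \<bullet> \<beta> + U i \<omega> \<ge> 0)"
  proof (intro AE_finite_allI)
    fix i assume i: "i \<in> {1..n}"
    note [measurable] = rv_U[OF i] rv_Y[OF i]
    have "{\<omega> \<in> space M. Y i \<omega> = of_bool (X i \<bullet> \<beta> + U i \<omega> \<ge> 0)} \<in> events" by measurable
    then show "AE \<omega> in M. Y i \<omega> = of_bool (X i \<bullet> \<beta> + U i \<omega> \<ge> 0)"
      using response[OF i] by (subst (asm) prob_Collect_eq_1)
  qed simp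
  then have dominated: "AE \<omega> in M. T (\<lambda>i. Y i \<omega>) \<le> T (\<lambda>i. Y_star U i \<omega>)"
  proof eventually_elim
    case (elim \<omega>)
    \<comment> \<open>With \<beta> = \<open>b\<close>: if the index is nonnegative,
      \<open>U i \<omega> \<ge> 0\<close> forces \<open>Y i \<omega> = 1\<close>; if it is
      nonpositive, \<open>Y i \<omega> = 1\<close> forces
      \<open>U i \<omega> \<ge> 0\<close>.\<close>
    then show ?case
      unfolding T_def using assms(2-4) H0
      by (intro test_stat_mono) (auto simp: Y_star_def)
  qed
  define q where "q = crit_val M U \<alpha> \<epsilon> V\<^sub>u V\<^sub>l n X b"
  have "1 - \<alpha> \<le> \<P>(\<omega> in M. T (\<lambda>i. Y_star U i \<omega>) \<le> q)"
    using prob_le_Inf_quantile[OF T_Y_star, of "1 - \<alpha>"] assms(5,6)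
    unfolding q_def crit_val_def T_def by simp
  \<comment> \<open>Up to a null set, a starred statistic below \<open>q\<close> puts the observed
    one below \<open>q\<close>; the measurability \<open>T_Y\<close> makes the larger set an
    event.\<close>
  also have "\<dots> \<le> \<P>(\<omega> in M. T (\<lambda>i. Y i \<omega>) \<le> q)"
    using dominated by (intro finite_measure_mono_AE) auto
  finally show ?thesis
    unfolding T_def q_def .
qed

end
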